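(* Let $n, i_1, j_1,\ldots,i_n,j_n$ be positive integers and $N:=i_1+j_1+\cdots+i_n+j_n$. Then $$\Omega'(i_1,j_1,\ldots,i_n,j_n)=\frac{1}{N+1}\sum_{k=1}^{n}\Omega'(i_1,j_1,\ldots,i_{k-1},j_{k-1},\,i_k-1)\;\Omega'(j_k-1,\,i_{k+1},j_{k+1},\ldots,i_n,j_n),$$ and $$\Omega'(i_1,j_1,\ldots,i_n,j_n)=\frac{1}{N+1}\sum_{k=0}^{n}\Omega'(i_1,j_1,\ldots,i_k,\,j_k-1)\;\Omega'(i_{k+1}-1,\,j_{k+1},\ldots,i_n,j_n),$$ where in the second formula, for $k=0$ the first factor has the empty argument list (so equals $\Omega'()=1$), and for $k=n$ the second factor has the empty argument list (so equals $1$).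
   Context: A permutation $\tau$ of $\{0,\ldots,M\}$ is said to increase (resp. decrease) on a set $\{p,\ldots,q\}\subseteq\{0,\ldots,M\}$ if $\tau(j)<\tau(j+1)$ (resp. $\tau(j)>\tau(j+1)$) for every $j=p,\ldots,q-1$ (vacuous when $p=q$). For a finite sequence $a_1,\ldots,a_m$ of nonnegative integers ($m\ge1$), put $M:=a_1+\cdots+a_m$, $t_0:=0$, $t_k:=a_1+\cdots+a_k$. Then $\Omega(a_1,\ldots,a_m)$ denotes the number of permutations of $\{0,\ldots,M\}$ which, for every $k=1,\ldots,m$, increase on $\{t_{k-1},\ldots,t_k\}$ if $k$ is odd and decrease on $\{t_{k-1},\ldots,t_k\}$ if $k$ is even (arguments alternately prescribe increasing and decreasing run lengths, starting with increasing). By convention $\Omega$ with no arguments equals $1$. Further, $\Omega'(a_1,\ldots,a_m):=\Omega(a_1,\ldots,a_m)/(a_1+\cdots+a_m+1)!$, and $\Omega'()=1$. *)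

theory Defs
  imports Complex_Main "HOL-Combinatorics.Permutations"
begin

definition increases_on :: "(nat \<Rightarrow> nat) \<Rightarrow> nat \<Rightarrow> nat \<Rightarrow> bool" where
  "increases_on \<tau> p q \<longleftrightarrow> (\<forall>j\<in>{p..<q}. \<tau> j < \<tau> (j + 1))"

definition decreases_on :: "(nat \<Rightarrow> nat) \<Rightarrow> nat \<Rightarrow> nat \<Rightarrow> bool" where
  "decreases_on \<tau> p q \<longleftrightarrow> (\<forall>j\<in>{p..<q}. \<tau> j > \<tau> (j + 1))"

definition run_end :: "nat list \<Rightarrow> nat \<Rightarrow> nat" where
  "run_end as k = sum_list (take k as)"

text \<open>
  The run of the list entry with (zero-based) index \<open>k - 1\<close> spans the positions from
  \<open>run_end as (k - 1)\<close> to \<open>run_end as k\<close>.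
\<close>

definition Omega :: "nat list \<Rightarrow> nat" where
  "Omega as =
     (if as = [] then 1
      else card {\<tau>. \<tau> permutes {0..sum_list as} \<and>
             (\<forall>k\<in>{1..length as}.
                (odd k \<longrightarrow> increases_on \<tau> (run_end as (k - 1)) (run_end as k)) \<and>
                (even k \<longrightarrow> decreases_on \<tau> (run_end as (k - 1)) (run_end as k)))})"

definition Omega' :: "nat list \<Rightarrow> real" where
  "Omega' as = real (Omega as) / fact (sum_list as + 1)"

text \<open>
  \<open>runs i j p q\<close> is the list \<open>i p, j p, ..., i q, j q\<close>; it is empty if \<open>q < p\<close>.
\<close>

definition runs :: "(nat \<Rightarrow> nat) \<Rightarrow> (nat \<Rightarrow> nat) \<Rightarrow> nat \<Rightarrow> nat \<Rightarrow> nat list" where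
  "runs i j p q = concat (map (\<lambda>l. [i l, j l]) [p..<q + 1])"

end

theory Submission
  imports Defs "HOL-Library.Infinite_Set"
begin

text \<open>
  Read a permutation as the list of its values and split it at its maximum. The maximum sits at a
  peak of the prescribed up/down word, that is, at the end of some increasing run \<open>i k\<close>; the two
  remaining pieces are arrangements of an arbitrary set of values and of its complement, each with
  its own up/down word, and their numbers depend only on the sizes of these sets. The binomial
  coefficient counting the choices is absorbed by the factorials in \<open>Omega'\<close>. The right-hand piece
  starts with a decreasing run, which complementing the values turns into an increasing one.
  Complementing the whole permutation replaces the maximum by the minimum and peaks by valleys,
  which gives the second formula.
\<close>

section \<open>Arrangements of a finite set of numbers with prescribed ascents and descents\<close>

text \<open>The pattern is a predicate on positions rather than a list: passing to a later piece is
  then an index shift, and exchanging ascents with descents is a pointwise negation.\<close>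

definition pat :: "(nat \<Rightarrow> bool) \<Rightarrow> nat list \<Rightarrow> bool" where
  "pat P xs \<longleftrightarrow> (\<forall>k. Suc k < length xs \<longrightarrow>
     (if P k then xs ! k < xs ! Suc k else xs ! Suc k < xs ! k))"

definition arrangements :: "(nat \<Rightarrow> bool) \<Rightarrow> nat set \<Rightarrow> nat list set" where
  "arrangements P S = {xs. distinct xs \<and> set xs = S \<and> pat P xs}"

definition count_pat :: "(nat \<Rightarrow> bool) \<Rightarrow> nat \<Rightarrow> nat" where
  "count_pat P m = card (arrangements P {..<m})"

lemma finite_arrangements: "finite S \<Longrightarrow> finite (arrangements P S)"
  unfolding arrangements_def by (rule finite_subset[OF _ finite_subset_distinct]) auto

lemma arrangements_empty [simp]: "arrangements P {} = {[]}"
  by (auto simp: arrangements_def pat_def)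

lemma count_pat_0 [simp]: "count_pat P 0 = 1"
  by (simp add: count_pat_def)

lemma length_arrangement: "xs \<in> arrangements P S \<Longrightarrow> length xs = card S"
  by (auto simp: arrangements_def distinct_card)

lemma pat_cong:
  assumes "\<And>k. Suc k < length xs \<Longrightarrow> P k = Q k"
  shows "pat P xs = pat Q xs"
  using assms by (simp add: pat_def)

lemma count_pat_cong:
  assumes "\<And>k. Suc k < m \<Longrightarrow> P k = Q k"
  shows "count_pat P m = count_pat Q m"
proof -
  have "arrangements P {..<m} = arrangements Q {..<m}"
  proof (rule set_eqI)
    fix xs
    show "xs \<in> arrangements P {..<m} \<longleftrightarrow> xs \<in> arrangements Q {..<m}"
      using pat_cong[of xs P Q] assms distinct_card[of xs]
      by (auto simp: arrangements_def)
  qed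
  then show ?thesis by (simp add: count_pat_def)
qed

text \<open>Two patterns are allowed so that the same transfer serves order-preserving relabellings,
  which keep the pattern, and order-reversing ones, which negate it.\<close>

lemma card_arrangements_bij:
  assumes bij: "bij_betw h A B"
    and rel: "\<And>xs. set xs \<subseteq> A \<Longrightarrow> pat Q (map h xs) = pat P xs"
  shows "card (arrangements P A) = card (arrangements Q B)"
proof (rule bij_betw_same_card)
  have inj: "inj_on h A" and img: "h ` A = B"
    using bij by (auto simp: bij_betw_def)
  show "bij_betw (map h) (arrangements P A) (arrangements Q B)"
    unfolding bij_betw_def
  proof
    show "inj_on (map h) (arrangements P A)"
      by (rule inj_onI) (use inj in \<open>auto simp: arrangements_def inj_on_def intro: map_inj_on\<close>)
    show "map h ` arrangements P A = arrangements Q B"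
    proof
      show "map h ` arrangements P A \<subseteq> arrangements Q B"
        using inj img rel by (auto simp: arrangements_def distinct_map)
      show "arrangements Q B \<subseteq> map h ` arrangements P A"
      proof
        fix ys assume ys: "ys \<in> arrangements Q B"
        define g where "g = inv_into A h"
        have eq: "map h (map g ys) = ys"
          using ys img by (auto simp: arrangements_def g_def f_inv_into_f intro!: map_idI)
        have st: "set (map g ys) = A"
          using ys inj img bij bij_betw_inv_into[OF bij]
          by (auto simp: arrangements_def g_def bij_betw_def)
        have "distinct (map g ys)"
          using ys eq by (metis (no_types, lifting) arrangements_def distinct_map mem_Collect_eq)
        then have "map g ys \<in> arrangements P A"
          using ys st eq rel[of "map g ys"] by (simp add: arrangements_def)
        then show "ys \<in> map h ` arrangements P A" using eq by (metis imageI)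
      qed
    qed
  qed
qed

text \<open>The increasing enumeration of \<open>S\<close> preserves every comparison, so only the
  size of \<open>S\<close> matters.\<close>

lemma card_arrangements:
  assumes "finite S"
  shows "card (arrangements P S) = count_pat P (card S)"
proof -
  obtain h where bij: "bij_betw h {..<card S} S" and mono: "strict_mono_on {..<card S} h"
    using ex_bij_betw_strict_mono_card[OF assms] by blast
  have "pat P (map h xs) = pat P xs" if xs: "set xs \<subseteq> {..<card S}" for xs
  proof -
    have "h (xs ! a) < h (xs ! b) \<longleftrightarrow> xs ! a < xs ! b"
      if "a < length xs" "b < length xs" for a b
    proof (rule strict_mono_on_less[OF mono])
      show "xs ! a \<in> {..<card S}" "xs ! b \<in> {..<card S}"
        using that xs nth_mem by blast+
    qed
    then show ?thesis by (simp add: pat_def)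
  qed
  then show ?thesis
    using card_arrangements_bij[OF bij, of P P] by (simp add: count_pat_def)
qed

text \<open>The involution sending \<open>x\<close> to \<open>m - 1 - x\<close> reverses the order
  of the values and so swaps ascents and descents.\<close>

lemma count_pat_Not: "count_pat (\<lambda>k. \<not> P k) m = count_pat P m"
  unfolding count_pat_def
proof (rule card_arrangements_bij)
  show "bij_betw (\<lambda>x. m - 1 - x) {..<m} {..<m}"
    by (rule bij_betwI[where g = "\<lambda>x. m - 1 - x"]) auto
  fix xs assume xs: "set xs \<subseteq> {..<m}"
  have "m - 1 - xs ! a < m - 1 - xs ! b \<longleftrightarrow> xs ! b < xs ! a"
    if "a < length xs" "b < length xs" for a b
  proof -
    have "xs ! a < m" "xs ! b < m" using that xs nth_mem by blast+
    then show ?thesis by auto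
  qed
  then show "pat P (map (\<lambda>x. m - 1 - x) xs) = pat (\<lambda>k. \<not> P k) xs"
    by (auto simp: pat_def)
qed

section \<open>Splitting an arrangement at its maximum\<close>

text \<open>The step into \<open>m\<close> must be an ascent and the step out of it a descent. These
  have indices \<open>length ys - 1\<close> and \<open>length ys\<close>, so the steps inside
  \<open>zs\<close> begin at index \<open>Suc (length ys)\<close>.\<close>

lemma pat_append_max:
  assumes "\<And>y. y \<in> set ys \<union> set zs \<Longrightarrow> y < m"
  shows "pat P (ys @ m # zs) \<longleftrightarrow>
    pat P ys \<and> pat (\<lambda>k. P (k + Suc (length ys))) zs \<and>
    (ys \<noteq> [] \<longrightarrow> P (length ys - 1)) \<and> (zs \<noteq> [] \<longrightarrow> \<not> P (length ys))"
    (is "?L \<longleftrightarrow> ?R")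
proof
  assume L: ?L
  then have step: "if P k then (ys @ m # zs) ! k < (ys @ m # zs) ! Suc k
      else (ys @ m # zs) ! Suc k < (ys @ m # zs) ! k"
    if "Suc k < Suc (length ys + length zs)" for k
    using that by (simp add: pat_def)
  have "pat P ys"
    unfolding pat_def
  proof (intro allI impI)
    fix k assume "Suc k < length ys"
    then show "if P k then ys ! k < ys ! Suc k else ys ! Suc k < ys ! k"
      using step[of k] by (auto simp: nth_append Suc_lessD split: if_splits)
  qed
  moreover have "pat (\<lambda>k. P (k + Suc (length ys))) zs"
    unfolding pat_def
  proof (intro allI impI)
    fix k assume "Suc k < length zs"
    then show "if P (k + Suc (length ys)) then zs ! k < zs ! Suc k else zs ! Suc k < zs ! k"
      using step[of "k + Suc (length ys)"] by (auto simp: nth_append split: if_splits)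
  qed
  moreover have "P (length ys - 1)" if "ys \<noteq> []"
    using step[of "length ys - 1"] that assms[of "ys ! (length ys - 1)"]
    by (auto simp: nth_append split: if_splits)
  moreover have "\<not> P (length ys)" if "zs \<noteq> []"
    using step[of "length ys"] that assms[of "zs ! 0"]
    by (auto simp: nth_append split: if_splits)
  ultimately show ?R by blast
next
  assume R: ?R
  show ?L
    unfolding pat_def
  proof (intro allI impI)
    fix k assume k: "Suc k < length (ys @ m # zs)"
    consider "Suc k < length ys" | "Suc k = length ys" | "k = length ys" | l where "k = l + Suc (length ys)"
      by (metis Suc_lessI add.commute less_iff_Suc_add linorder_neqE_nat add_Suc_right)
    then show "if P k then (ys @ m # zs) ! k < (ys @ m # zs) ! Suc k
      else (ys @ m # zs) ! Suc k < (ys @ m # zs) ! k"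
    proof cases
      case 1
      then show ?thesis using R by (simp add: pat_def nth_append)
    next
      case 2
      then have "P k" using R by (metis diff_Suc_1 length_0_conv nat.distinct(1))
      moreover have "ys ! k < m" using 2 assms by (metis UnCI lessI nth_mem)
      ultimately show ?thesis using 2 by (simp add: nth_append)
    next
      case 3
      then have "zs \<noteq> []" using k by auto
      then show ?thesis using 3 R assms[of "zs ! 0"] by (simp add: nth_append)
    next
      case 4
      then show ?thesis using R k by (simp add: pat_def nth_append)
    qed
  qed
qed

text \<open>
  The maximum of an arrangement of \<open>m + 1\<close> values may stand at either end, so the endpoints
  \<open>0\<close> and \<open>m\<close> count as peaks when their only neighbouring step allows it.
\<close>

definition peak :: "(nat \<Rightarrow> bool) \<Rightarrow> nat \<Rightarrow> nat \<Rightarrow> bool" where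
  "peak P m p \<longleftrightarrow> p \<le> m \<and> (0 < p \<longrightarrow> P (p - 1)) \<and> (p < m \<longrightarrow> \<not> P p)"

text \<open>Grouping the subsets by size produces the binomial coefficient; \<open>T\<close> is
  later taken to be \<open>peak P m\<close>.\<close>

lemma sum_card_subsets:
  fixes g :: "nat \<Rightarrow> nat"
  shows "(\<Sum>A | A \<subseteq> {..<m} \<and> T (card A). g (card A)) = (\<Sum>p | p \<le> m \<and> T p. (m choose p) * g p)"
proof -
  let ?X = "{A. A \<subseteq> {..<m} \<and> T (card A)}"
  let ?Y = "{p. p \<le> m \<and> T p}"
  have fin: "finite ?X" by (rule finite_subset[of _ "Pow {..<m}"]) auto
  have sub: "card ` ?X \<subseteq> ?Y"
    using card_mono[of "{..<m}"] by auto
  have "(\<Sum>A\<in>?X. g (card A)) = (\<Sum>p\<in>?Y. \<Sum>A | A \<in> ?X \<and> card A = p. g (card A))"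
    using sum.group[OF fin _ sub, of "\<lambda>A. g (card A)"] by simp
  also have "\<dots> = (\<Sum>p\<in>?Y. (m choose p) * g p)"
  proof (rule sum.cong[OF refl])
    fix p assume "p \<in> ?Y"
    then have "{A. A \<in> ?X \<and> card A = p} = {A. A \<subseteq> {..<m} \<and> card A = p}" by auto
    then have "card {A. A \<in> ?X \<and> card A = p} = m choose p"
      using n_subsets[of "{..<m}" p] by simp
    then show "(\<Sum>A | A \<in> ?X \<and> card A = p. g (card A)) = (m choose p) * g p"
      by simp
  qed
  finally show ?thesis .
qed

text \<open>Cutting at the maximum \<open>m\<close> is a bijection onto triples: a set of values for
  the left piece, an arrangement of it, and an arrangement of its complement in
  \<open>{..<m}\<close>.\<close>

lemma count_pat_Suc:
  "count_pat P (Suc m) =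
    (\<Sum>p | peak P m p. (m choose p) * (count_pat P p * count_pat (\<lambda>k. P (k + Suc p)) (m - p)))"
proof -
  \<comment> \<open>\<open>A\<close> is the set of values to the left of the maximum. Its size is
    the position of \<open>m\<close>, so the peak condition depends on \<open>A\<close> only through
    \<open>card A\<close>.\<close>
  let ?X = "{A. A \<subseteq> {..<m} \<and> peak P m (card A)}"
  let ?B = "\<lambda>A. arrangements P A \<times> arrangements (\<lambda>k. P (k + Suc (card A))) ({..<m} - A)"
  let ?f = "\<lambda>(A :: nat set, ys, zs). ys @ m # zs"
  have finX: "finite ?X" by (rule finite_subset[of _ "Pow {..<m}"]) auto
  have finA: "finite A" if "A \<in> ?X" for A using that finite_subset by blast
  have inj: "inj_on ?f (Sigma ?X ?B)"
  proof (rule inj_onI)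
    fix x y assume xy: "x \<in> Sigma ?X ?B" "y \<in> Sigma ?X ?B" "?f x = ?f y"
    obtain A ys zs where x: "x = (A, ys, zs)" by (cases x)
    obtain B ys' zs' where y: "y = (B, ys', zs')" by (cases y)
    have "m \<notin> set ys" "m \<notin> set ys'" "m \<notin> set zs" "m \<notin> set zs'"
      and sets: "set ys = A" "set ys' = B"
      using xy x y by (auto simp: arrangements_def)
    moreover have "ys @ m # zs = ys' @ m # zs'" using xy x y by simp
    ultimately have "ys = ys' \<and> zs = zs'"
      by (simp add: append_Cons_eq_iff)
    then show "x = y" using x y sets by auto
  qed
  have img: "?f ` Sigma ?X ?B = arrangements P {..<Suc m}"
  proof (rule subset_antisym)
    show "?f ` Sigma ?X ?B \<subseteq> arrangements P {..<Suc m}"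
    proof (rule image_subsetI)
      fix x assume x: "x \<in> Sigma ?X ?B"
      obtain A ys zs where xe: "x = (A, ys, zs)" by (cases x)
      have A: "A \<subseteq> {..<m}" "peak P m (card A)"
        and ys: "ys \<in> arrangements P A"
        and zs: "zs \<in> arrangements (\<lambda>k. P (k + Suc (card A))) ({..<m} - A)"
        using x xe by auto
      have len: "length ys = card A" using ys length_arrangement by blast
      have lenz: "length zs = m - card A"
        using length_arrangement[OF zs] A(1) by (simp add: card_Diff_subset finite_subset)
      have st: "set ys = A" "set zs = {..<m} - A" "distinct ys" "distinct zs"
        using ys zs by (auto simp: arrangements_def)
      have "pat P (ys @ m # zs)"
      proof (subst pat_append_max)
        show "y < m" if "y \<in> set ys \<union> set zs" for y using that st A(1) by auto
        show "pat P ys \<and> pat (\<lambda>k. P (k + Suc (length ys))) zs \<and>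
          (ys \<noteq> [] \<longrightarrow> P (length ys - 1)) \<and> (zs \<noteq> [] \<longrightarrow> \<not> P (length ys))"
        proof (intro conjI impI)
          show "pat P ys" using ys by (simp add: arrangements_def)
          show "pat (\<lambda>k. P (k + Suc (length ys))) zs"
            using zs unfolding len by (simp add: arrangements_def)
          show "P (length ys - 1)" if "ys \<noteq> []"
            using that A(2) unfolding peak_def len[symmetric] by simp
          show "\<not> P (length ys)" if "zs \<noteq> []"
            using that A(2) lenz unfolding peak_def len[symmetric] by (metis length_greater_0_conv zero_less_diff)
        qed
      qed
      then have "ys @ m # zs \<in> arrangements P {..<Suc m}"
        using st A(1) by (auto simp: arrangements_def)
      then show "?f x \<in> arrangements P {..<Suc m}" by (simp add: xe)
    qed
    show "arrangements P {..<Suc m} \<subseteq> ?f ` Sigma ?X ?B"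
    proof
      fix xs assume xs: "xs \<in> arrangements P {..<Suc m}"
      then have "m \<in> set xs" by (auto simp: arrangements_def)
      then obtain ys zs where e: "xs = ys @ m # zs" by (meson split_list)
      have d: "distinct ys" "distinct zs" "set ys \<inter> set zs = {}" "m \<notin> set ys" "m \<notin> set zs"
        and un: "set ys \<union> set zs \<union> {m} = {..<Suc m}"
        and pt: "pat P (ys @ m # zs)"
        using xs e by (auto simp: arrangements_def)
      have un': "set ys \<union> set zs = {..<m}"
        using un d by (auto simp: lessThan_Suc)
      have zsset: "set zs = {..<m} - set ys" using un' d by auto
      have len: "card (set ys) = length ys" using d distinct_card by blast
      have lenm: "m = length ys + length zs"
        using un' d card_Un_disjoint[of "set ys" "set zs"] by (simp add: distinct_card)
      have R: "pat P ys \<and> pat (\<lambda>k. P (k + Suc (length ys))) zs \<and>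
          (ys \<noteq> [] \<longrightarrow> P (length ys - 1)) \<and> (zs \<noteq> [] \<longrightarrow> \<not> P (length ys))"
        using pt by (subst (asm) pat_append_max) (use un' in auto)
      have "(set ys, ys, zs) \<in> Sigma ?X ?B"
        using R un' zsset d len lenm by (auto simp: arrangements_def peak_def)
      then show "xs \<in> ?f ` Sigma ?X ?B"
        by (rule rev_image_eqI) (simp add: e)
    qed
  qed
  have "count_pat P (Suc m) = card (Sigma ?X ?B)"
    unfolding count_pat_def img[symmetric] by (rule card_image[OF inj])
  also have "\<dots> = (\<Sum>A\<in>?X. card (?B A))"
    by (intro card_SigmaI finX ballI finite_cartesian_product finite_arrangements finite_Diff
        finite_lessThan) (rule finA)
  also have "\<dots> = (\<Sum>A\<in>?X. count_pat P (card A) * count_pat (\<lambda>k. P (k + Suc (card A))) (m - card A))"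
  proof (rule sum.cong[OF refl])
    fix A assume A: "A \<in> ?X"
    show "card (?B A) = count_pat P (card A) * count_pat (\<lambda>k. P (k + Suc (card A))) (m - card A)"
      using A finA[OF A]
      by (simp add: card_cartesian_product card_arrangements card_Diff_subset)
  qed
  also have "\<dots> = (\<Sum>p | p \<le> m \<and> peak P m p. (m choose p) * (count_pat P p * count_pat (\<lambda>k. P (k + Suc p)) (m - p)))"
    by (rule sum_card_subsets)
  also have "{p. p \<le> m \<and> peak P m p} = {p. peak P m p}" by (auto simp: peak_def)
  finally show ?thesis .
qed

section \<open>Normalised counts and their recurrences\<close>

text \<open>This is the probability that a uniformly random arrangement of \<open>m\<close> values
  follows the pattern.\<close>

definition prob_pat :: "(nat \<Rightarrow> bool) \<Rightarrow> nat \<Rightarrow> real" where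
  "prob_pat P m = real (count_pat P m) / fact m"

text \<open>Dividing \<open>m choose p\<close> by \<open>fact (Suc m)\<close> leaves
  \<open>1 / (m + 1)\<close> and one inverse factorial for each piece.\<close>

lemma prob_pat_Suc:
  "prob_pat P (Suc m) =
    1 / (real m + 1) * (\<Sum>p | peak P m p. prob_pat P p * prob_pat (\<lambda>k. P (k + Suc p)) (m - p))"
proof -
  have "real (m choose p) * (a * b) / fact (Suc m) = 1 / (real m + 1) * (a / fact p * (b / fact (m - p)))"
    if "peak P m p" for p and a b :: real
    using that by (simp add: binomial_fact peak_def divide_simps)
  then show ?thesis
    by (simp add: prob_pat_def count_pat_Suc sum_divide_distrib sum_distrib_left del: fact_Suc)
qed

lemma prob_pat_0 [simp]: "prob_pat P 0 = 1"
  by (simp add: prob_pat_def)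

lemma prob_pat_Not: "prob_pat (\<lambda>k. \<not> P k) m = prob_pat P m"
  by (simp add: prob_pat_def count_pat_Not)

text \<open>This amounts to splitting at the minimum. The recurrence for the negated pattern is
  used; complementation removes the negation from all three probabilities, and it survives only in
  the set of split positions.\<close>

lemma prob_pat_Suc_valley:
  "prob_pat P (Suc m) =
    1 / (real m + 1) *
    (\<Sum>p | peak (\<lambda>k. \<not> P k) m p. prob_pat P p * prob_pat (\<lambda>k. P (k + Suc p)) (m - p))"
  using prob_pat_Suc[of "\<lambda>k. \<not> P k" m]
  by (simp add: prob_pat_Not)

text \<open>A word lists the steps between entries, so there is one entry more than there are
  letters.\<close>

definition prob_word :: "bool list \<Rightarrow> real" where
  "prob_word w = prob_pat (nth w) (Suc (length w))"

lemma prob_pat_cong: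
  "(\<And>k. Suc k < m \<Longrightarrow> P k = Q k) \<Longrightarrow> prob_pat P m = prob_pat Q m"
  using count_pat_cong[of m P Q] by (simp add: prob_pat_def)

lemma prob_pat_take:
  "prob_pat (nth (u @ v)) (Suc (length u)) = prob_word u"
  unfolding prob_word_def by (rule prob_pat_cong) (simp add: nth_append)

lemma prob_pat_drop:
  "prob_pat (\<lambda>k. (u @ v) ! (k + length u)) (Suc (length v)) = prob_word v"
  unfolding prob_word_def by (rule prob_pat_cong) (simp add: nth_append)

text \<open>This turns a piece that starts with a decreasing run into one that starts with an
  increasing run, as \<open>Omega'\<close> requires.\<close>

lemma prob_word_map_Not: "prob_word (map Not w) = prob_word w"
proof -
  have "prob_word (map Not w) = prob_pat (\<lambda>k. \<not> w ! k) (Suc (length w))"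
    unfolding prob_word_def length_map by (rule prob_pat_cong) simp
  then show ?thesis by (simp add: prob_pat_Not prob_word_def)
qed

section \<open>From run lengths and permutations to up/down words\<close>

fun word :: "bool \<Rightarrow> nat list \<Rightarrow> bool list" where
  "word b [] = []"
| "word b (a # as) = replicate a b @ word (\<not> b) as"

lemma length_word [simp]: "length (word b as) = sum_list as"
  by (induction as arbitrary: b) auto

lemma word_append:
  "word b (as @ bs) = word b as @ word (b = even (length as)) bs"
proof (induction as arbitrary: b)
  case (Cons a as)
  have "((\<not> b) = even (length as)) = (b = even (length (a # as)))" by auto
  then show ?case using Cons by simp
qed simp

lemma word_Not: "word (\<not> b) as = map Not (word b as)"
  by (induction as arbitrary: b) (auto simp: map_replicate_const comp_def)

text \<open>The induction appends runs at the end, because this leaves the endpoints and letters of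
  all earlier runs unchanged.\<close>

lemma word_monotone_runs:
  "(\<forall>k\<in>{1..length as}.
      (odd k \<longrightarrow> increases_on \<tau> (run_end as (k - 1)) (run_end as k)) \<and>
      (even k \<longrightarrow> decreases_on \<tau> (run_end as (k - 1)) (run_end as k)))
   \<longleftrightarrow> (\<forall>q<sum_list as. if word True as ! q then \<tau> q < \<tau> (Suc q) else \<tau> (Suc q) < \<tau> q)"
proof (induction as rule: rev_induct)
  case Nil
  then show ?case by simp
next
  case (snoc a as)
  let ?run = "\<lambda>as k. (odd k \<longrightarrow> increases_on \<tau> (run_end as (k - 1)) (run_end as k)) \<and>
      (even k \<longrightarrow> decreases_on \<tau> (run_end as (k - 1)) (run_end as k))"
  let ?st = "\<lambda>b q. if b then \<tau> q < \<tau> (Suc q) else \<tau> (Suc q) < \<tau> q"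
  have "(\<forall>k\<in>{1..length (as @ [a])}. ?run (as @ [a]) k) \<longleftrightarrow>
      (\<forall>k\<in>{1..length as}. ?run (as @ [a]) k) \<and> ?run (as @ [a]) (Suc (length as))"
  proof -
    have "{1..length (as @ [a])} = insert (Suc (length as)) {1..length as}" by auto
    then show ?thesis by (simp only: ball_simps(7) conj_commute)
  qed
  also have "(\<forall>k\<in>{1..length as}. ?run (as @ [a]) k) \<longleftrightarrow> (\<forall>k\<in>{1..length as}. ?run as k)"
    by (intro ball_cong refl) (simp add: run_end_def)
  also have "\<dots> \<longleftrightarrow> (\<forall>q<sum_list as. ?st (word True as ! q) q)"
    by (rule snoc.IH)
  \<comment> \<open>Runs are numbered from one, so the appended run has odd number, and is
    increasing, exactly when \<open>length as\<close> is even.\<close>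
  also have "?run (as @ [a]) (Suc (length as)) \<longleftrightarrow>
      (\<forall>q\<in>{sum_list as..<sum_list as + a}. ?st (even (length as)) q)"
    by (cases "even (length as)") (simp_all add: run_end_def increases_on_def decreases_on_def)
  also have "(\<forall>q<sum_list as. ?st (word True as ! q) q) \<and> \<dots> \<longleftrightarrow>
      (\<forall>q<sum_list (as @ [a]). ?st (word True (as @ [a]) ! q) q)"
  proof -
    have nth: "word True (as @ [a]) ! q = (if q < sum_list as then word True as ! q else even (length as))"
      if "q < sum_list as + a" for q
      using that by (simp add: word_append nth_append)
    have "(\<forall>q<sum_list as + a. Q q) \<longleftrightarrow>
        (\<forall>q<sum_list as. Q q) \<and> (\<forall>q\<in>{sum_list as..<sum_list as + a}. Q q)" for Q
      by (meson atLeastLessThan_iff not_le trans_less_add1)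
    from this[of "\<lambda>q. ?st (word True (as @ [a]) ! q) q"] show ?thesis
      by (simp add: nth)
  qed
  finally show ?case .
qed

text \<open>A permutation of \<open>{0..M}\<close> is identified with the list of its values. The
  conventional value 1 for no arguments agrees with the single arrangement
  \<open>[0]\<close>.\<close>

lemma Omega_eq_count_pat: "Omega as = count_pat (nth (word True as)) (Suc (sum_list as))"
proof (cases "as = []")
  case True
  have "arrangements P {..<Suc 0} = {[0]}" for P
  proof -
    have "xs = [0]" if xs: "xs \<in> arrangements P {..<Suc 0}" for xs
    proof -
      obtain x where "xs = [x]"
        using length_arrangement[OF xs] by (cases xs) auto
      then show ?thesis using xs by (simp add: arrangements_def lessThan_Suc)
    qed
    then show ?thesis by (auto simp: arrangements_def pat_def)
  qed
  then show ?thesis using True by (simp add: Omega_def count_pat_def)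
next
  case False
  let ?M = "sum_list as"
  let ?st = "\<lambda>\<tau>. \<forall>q<?M. if word True as ! q then \<tau> q < \<tau> (Suc q) else \<tau> (Suc q) < \<tau> q"
  let ?T = "{\<tau>. \<tau> permutes {0..?M} \<and> ?st \<tau>}"
  have "card ?T = card (arrangements (nth (word True as)) {..<Suc ?M})"
  proof (rule bij_betw_same_card)
    let ?F = "\<lambda>\<tau>. map \<tau> [0..<Suc ?M]"
    have nth: "?F \<tau> ! q = \<tau> q" if "q \<le> ?M" for \<tau> q
      using that by (metis add_0 diff_zero length_upt less_Suc_eq_le nth_map nth_upt)
    have pat_iff: "pat (nth (word True as)) (?F \<tau>) \<longleftrightarrow> ?st \<tau>" for \<tau>
      unfolding pat_def by (simp add: nth del: upt_Suc)
    have S: "{0..?M} = {..<Suc ?M}" by auto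
    show "bij_betw ?F ?T (arrangements (nth (word True as)) {..<Suc ?M})"
      unfolding bij_betw_def
    proof
      show "inj_on ?F ?T"
      proof (rule inj_onI)
        fix \<sigma> \<tau> assume a: "\<sigma> \<in> ?T" "\<tau> \<in> ?T" "?F \<sigma> = ?F \<tau>"
        show "\<sigma> = \<tau>"
        proof
          fix q show "\<sigma> q = \<tau> q"
          proof (cases "q \<le> ?M")
            case True then show ?thesis using a(3) nth by metis
          next
            case False then show ?thesis using a(1,2) by (auto simp: permutes_def)
          qed
        qed
      qed
      show "?F ` ?T = arrangements (nth (word True as)) {..<Suc ?M}"
      proof
        show "?F ` ?T \<subseteq> arrangements (nth (word True as)) {..<Suc ?M}"
        proof (rule image_subsetI)
          fix \<tau> assume t: "\<tau> \<in> ?T"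
          then have p: "\<tau> permutes {..<Suc ?M}" using S by auto
          have "distinct (?F \<tau>)"
            using permutes_inj_on[OF p] by (simp add: distinct_map del: upt_Suc)
          moreover have "set (?F \<tau>) = {..<Suc ?M}"
            using permutes_image[OF p] by (simp add: atLeast0LessThan del: upt_Suc)
          ultimately show "?F \<tau> \<in> arrangements (nth (word True as)) {..<Suc ?M}"
            unfolding arrangements_def using t pat_iff by blast
        qed
        show "arrangements (nth (word True as)) {..<Suc ?M} \<subseteq> ?F ` ?T"
        proof
          fix xs assume xs: "xs \<in> arrangements (nth (word True as)) {..<Suc ?M}"
          have len: "length xs = Suc ?M" using length_arrangement[OF xs] by simp
          \<comment> \<open>Outside the range the function must be the identity, as
            \<open>permutes\<close> demands.\<close>
          define \<tau> where "\<tau> = (\<lambda>q. if q < Suc ?M then xs ! q else q)"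
          have F: "?F \<tau> = xs"
            by (rule nth_equalityI) (simp_all add: len \<tau>_def del: upt_Suc)
          have "bij_betw (nth xs) {..<Suc ?M} {..<Suc ?M}"
            using xs len by (intro bij_betw_nth) (auto simp: arrangements_def)
          then have "bij_betw \<tau> {..<Suc ?M} {..<Suc ?M}"
            by (rule bij_betw_cong[THEN iffD1, rotated]) (simp add: \<tau>_def)
          then have "\<tau> permutes {0..?M}"
            unfolding S by (rule bij_imp_permutes) (simp add: \<tau>_def)
          moreover have "?st \<tau>"
            using xs F pat_iff[of \<tau>] by (simp add: arrangements_def)
          ultimately show "xs \<in> ?F ` ?T" using F by (intro rev_image_eqI[of \<tau>]) auto
        qed
      qed
    qed
  qed
  then show ?thesis
    unfolding Omega_def count_pat_def word_monotone_runs using False by simp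
qed

lemma Omega'_eq_prob_word: "Omega' as = prob_word (word True as)"
  by (simp add: Omega'_def prob_word_def prob_pat_def Omega_eq_count_pat)

lemma Omega'_Nil [simp]: "Omega' [] = 1"
  by (simp add: Omega'_def Omega_def)

section \<open>Peaks and valleys of words with alternating runs\<close>

lemma runs_empty [simp]: "q < p \<Longrightarrow> runs i j p q = []"
  by (simp add: runs_def)

text \<open>Positivity of \<open>p\<close> makes \<open>k - 1\<close> a genuine predecessor, so the
  first block is empty when \<open>k = p\<close>.\<close>

lemma runs_split:
  assumes "0 < p" "p \<le> k" "k \<le> q"
  shows "runs i j p q = runs i j p (k - 1) @ [i k, j k] @ runs i j (k + 1) q"
proof -
  have "[p..<Suc q] = [p..<k] @ [k..<Suc q]"
    using assms by (metis le_SucI le_add_diff_inverse upt_add_eq_append)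
  also have "[k..<Suc q] = k # [Suc k..<Suc q]"
    using assms by (simp add: upt_conv_Cons del: upt_Suc)
  finally show ?thesis using assms by (simp add: runs_def del: upt_Suc)
qed

lemma length_runs_even [simp]: "even (length (runs i j p q))"
  unfolding runs_def by (induction q) auto

lemma word_runs_snoc:
  "word True (runs i j 1 (Suc n)) =
    word True (runs i j 1 n) @ replicate (i (Suc n)) True @ replicate (j (Suc n)) False"
  using runs_split[of 1 "Suc n" "Suc n" i j] by (simp add: word_append)

lemma sum_list_runs: "sum_list (runs i j p q) = (\<Sum>k=p..q. i k + j k)"
  by (induction q) (auto simp: runs_def)

text \<open>Peaks are the ends of increasing runs, valleys the ends of decreasing runs. Position 0
  is left out to keep the induction uniform: for the empty word it is both a peak and a
  valley.\<close>

lemma peaks_valleys_runs: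
  fixes i j :: "nat \<Rightarrow> nat"
  defines "s \<equiv> \<lambda>k. \<Sum>l=1..k. i l + j l"
  assumes "\<And>k. k \<in> {1..n} \<Longrightarrow> i k \<ge> 1" "\<And>k. k \<in> {1..n} \<Longrightarrow> j k \<ge> 1"
  shows "{p. 0 < p \<and> peak (nth (word True (runs i j 1 n))) (s n) p} =
      (\<lambda>k. s (k - 1) + i k) ` {1..n} \<and>
    {p. 0 < p \<and> peak (\<lambda>q. \<not> word True (runs i j 1 n) ! q) (s n) p} = s ` {1..n}"
  using assms(2,3)
proof (induction n)
  case 0
  then show ?case by (auto simp: s_def peak_def)
next
  case (Suc n)
  let ?W = "word True (runs i j 1 n)" and ?W' = "word True (runs i j 1 (Suc n))"
  let ?t = "\<lambda>k. s (k - 1) + i k"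
  have IH: "{p. 0 < p \<and> peak (nth ?W) (s n) p} = ?t ` {1..n}"
    "{p. 0 < p \<and> peak (\<lambda>q. \<not> ?W ! q) (s n) p} = s ` {1..n}"
    using Suc by auto
  have s_Suc: "s (Suc n) = s n + (i (Suc n) + j (Suc n))" by (simp add: s_def)
  have pos: "i (Suc n) > 0" "j (Suc n) > 0" using Suc.prems[of "Suc n"] by auto
  have len: "length ?W = s n" by (simp add: sum_list_runs s_def)
  have nth': "?W' ! q = (if q < s n then ?W ! q else q < s n + i (Suc n))"
    if "q < s (Suc n)" for q
    using that unfolding word_runs_snoc by (auto simp: nth_append len s_Suc simp del: length_word One_nat_def)
  \<comment> \<open>By the induction hypothesis the endpoint \<open>s n\<close> is a valley of the
    old word, so its last letter is a descent.\<close>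
  have last: "\<not> ?W ! q" if "s n = Suc q" for q
  proof -
    have "n > 0" using that by (cases n) (auto simp: s_def)
    then have "s n \<in> s ` {1..n}" by auto
    then show ?thesis unfolding IH(2)[symmetric] by (simp add: peak_def that)
  qed
  \<comment> \<open>The junction \<open>s n\<close> is entered by a descent, so the only new peak
    lies between the two appended runs.\<close>
  have peaks: "0 < p \<and> peak (nth ?W') (s (Suc n)) p \<longleftrightarrow>
      (0 < p \<and> peak (nth ?W) (s n) p) \<or> p = s n + i (Suc n)" for p
  proof (cases p)
    case 0
    then show ?thesis using pos by (simp add: s_Suc)
  next
    case (Suc p')
    then show ?thesis
      unfolding peak_def using pos last[of p'] nth'[of p] nth'[of p']
      by (cases "s n = Suc p'") (auto simp: s_Suc Suc_le_eq split: if_splits)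
  qed
  \<comment> \<open>The old endpoint \<open>s n\<close> remains a valley since an increasing run now
    follows it; the new endpoint is added.\<close>
  have valleys: "0 < p \<and> peak (\<lambda>q. \<not> ?W' ! q) (s (Suc n)) p \<longleftrightarrow>
      (0 < p \<and> peak (\<lambda>q. \<not> ?W ! q) (s n) p) \<or> p = s (Suc n)" for p
  proof (cases p)
    case 0
    then show ?thesis using pos by (simp add: s_Suc)
  next
    case (Suc p')
    then show ?thesis
      unfolding peak_def using pos last[of p'] nth'[of p] nth'[of p']
      by (cases "s n = Suc p'") (auto simp: s_Suc Suc_le_eq split: if_splits)
  qed
  show ?case
    unfolding peaks valleys Collect_disj_eq IH by (simp add: atLeastAtMostSuc_conv)
qed

text \<open>
  Deleting the entry at an interior position \<open>p\<close> removes the two letters \<open>x\<close> and \<open>y\<close>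
  describing the steps into and out of \<open>p\<close>.
\<close>

lemma prob_pat_split:
  assumes "w = u @ x # y # v" "p = Suc (length u)" "m = length w"
  shows "prob_pat (nth w) p = prob_word u"
    and "prob_pat (\<lambda>k. w ! (k + Suc p)) (m - p) = prob_word v"
  using prob_pat_take[of u "x # y # v"] prob_pat_drop[of "u @ [x, y]" v] assms by simp_all

theorem theorem2:
  fixes n N :: nat and i j :: "nat \<Rightarrow> nat"
  assumes "n \<ge> 1"
    and "\<And>k. k \<in> {1..n} \<Longrightarrow> i k \<ge> 1"
    and "\<And>k. k \<in> {1..n} \<Longrightarrow> j k \<ge> 1"
    and "N = (\<Sum>k=1..n. i k + j k)"
  shows "Omega' (runs i j 1 n) =
           1 / (real N + 1) *
           (\<Sum>k=1..n. Omega' (runs i j 1 (k - 1) @ [i k - 1]) *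
                      Omega' ((j k - 1) # runs i j (k + 1) n))
       \<and> Omega' (runs i j 1 n) =
           1 / (real N + 1) *
           (\<Sum>k=0..n. Omega' (if k = 0 then [] else runs i j 1 (k - 1) @ [i k, j k - 1]) *
                      Omega' (if k = n then []
                              else (i (k + 1) - 1) # j (k + 1) # runs i j (k + 2) n))"
proof -
  define W where "W = word True (runs i j 1 n)"
  \<comment> \<open>\<open>s k\<close> is the valley after the first \<open>k\<close> pairs of runs,
    and \<open>t k\<close> is the peak inside the \<open>k\<close>-th pair.\<close>
  define s where "s k = (\<Sum>l=1..k. i l + j l)" for k
  define t where "t k = s (k - 1) + i k" for k
  have len: "length W = N" using assms(4) by (simp add: W_def sum_list_runs)
  have sN: "s n = N" using assms(4) by (simp add: s_def)
  have s_step: "s k = t k + j k" if "k \<in> {1..n}" for k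
    using that by (cases k) (auto simp: s_def t_def)
  have i_pos: "i k = Suc (i k - 1)" and j_pos: "j k = Suc (j k - 1)" if "k \<in> {1..n}" for k
    using assms(2,3)[OF that] by auto
  \<comment> \<open>The two rules peel one letter off a nonempty run, at its left or right end; this
    letter is the step adjacent to the split, hence the lengths reduced by one.\<close>
  have rep: "replicate a b = b # replicate (a - 1) b" if "a = Suc (a - 1)" for a and b :: bool
    using that by (metis replicate_Suc)
  have rep': "replicate a b = replicate (a - 1) b @ [b]" if "a = Suc (a - 1)" for a and b :: bool
    using that by (metis replicate_Suc replicate_append_same)
  have W_split: "W = word True (runs i j 1 (k - 1)) @ replicate (i k) True @
      replicate (j k) False @ word True (runs i j (k + 1) n)" if "k \<in> {1..n}" for k
    using runs_split[of 1 k n i j] that unfolding W_def by (simp add: word_append)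
  have len_runs: "length (word True (runs i j 1 k)) = s k" for k
    by (simp add: sum_list_runs s_def)
  \<comment> \<open>The first letter is an ascent, so position 0 is a valley but not a peak. This is
    why the second sum starts at \<open>k = 0\<close> and the first at \<open>k = 1\<close>.\<close>
  have W0: "W ! 0" "0 < N"
    using W_split[of 1] assms(1) rep[OF i_pos[of 1]] len by (auto simp: runs_def)
  have mono: "s k < s l" if "k < l" "l \<le> n" for k l
    using that
  proof (induction l)
    case (Suc l)
    have "s l < s (Suc l)" using assms(2)[of "Suc l"] Suc.prems by (simp add: s_def)
    then show ?case using Suc by (cases "k = l") auto
  qed simp
  have inj_s: "inj_on s {0..n}"
    by (rule linorder_inj_onI') (metis atLeastAtMost_iff less_irrefl mono)
  \<comment> \<open>Peaks and valleys interlace: \<open>t k < s k \<le> s (l - 1) \<le> t l\<close>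
    for \<open>k < l\<close>.\<close>
  have inj_t: "inj_on t {1..n}"
  proof (rule linorder_inj_onI')
    fix k l assume kl: "k \<in> {1..n}" "l \<in> {1..n}" "k < l"
    have "t k < s k" using s_step j_pos kl by (metis less_add_same_cancel1 zero_less_Suc)
    also have "s k \<le> s (l - 1)"
    proof (cases "k = l - 1")
      case False
      then have "k < l - 1" "l - 1 \<le> n" using kl by auto
      then show ?thesis using mono less_imp_le by blast
    qed simp
    also have "\<dots> \<le> t l" by (simp add: t_def)
    finally show "t k \<noteq> t l" by simp
  qed
  have pv: "{p. 0 < p \<and> peak (nth W) N p} = t ` {1..n}"
    "{p. 0 < p \<and> peak (\<lambda>q. \<not> W ! q) N p} = s ` {1..n}"
    using peaks_valleys_runs[of n i j] assms(2,3)
    unfolding W_def sN[symmetric] s_def[abs_def] t_def[abs_def] by auto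
  have "{p. peak (nth W) N p} = {p. 0 < p \<and> peak (nth W) N p}"
    using W0 by (auto simp: peak_def intro: gr0I)
  then have peaks: "{p. peak (nth W) N p} = t ` {1..n}" using pv by simp
  have "{p. peak (\<lambda>q. \<not> W ! q) N p} = insert 0 {p. 0 < p \<and> peak (\<lambda>q. \<not> W ! q) N p}"
    using W0 by (auto simp: peak_def)
  also have "\<dots> = s ` insert 0 {1..n}" using pv by (simp add: s_def)
  also have "insert 0 {1..n} = {0..n}" by auto
  finally have valleys: "{p. peak (\<lambda>q. \<not> W ! q) N p} = s ` {0..n}" .
  have Omega'_runs: "Omega' (runs i j 1 n) = prob_pat (nth W) (Suc N)"
    by (simp only: Omega'_eq_prob_word prob_word_def len flip: W_def)
  have peak_term: "prob_pat (nth W) (t k) * prob_pat (\<lambda>q. W ! (q + Suc (t k))) (N - t k) =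
      Omega' (runs i j 1 (k - 1) @ [i k - 1]) * Omega' ((j k - 1) # runs i j (k + 1) n)"
    if k: "k \<in> {1..n}" for k
  proof -
    let ?u = "word True (runs i j 1 (k - 1) @ [i k - 1])"
    \<comment> \<open>After a peak the remaining word starts inside a decreasing run, so it is
      written as the negation of a word starting with an ascent.\<close>
    let ?v = "map Not (word True ((j k - 1) # runs i j (k + 1) n))"
    have neg: "?v = replicate (j k - 1) False @ word True (runs i j (k + 1) n)"
      using word_Not[of False "runs i j (k + 1) n"] by simp
    have "W = ?u @ True # False # ?v"
      unfolding neg W_split[OF k] rep'[OF i_pos[OF k]] rep[OF j_pos[OF k]]
      by (simp add: word_append)
    moreover have "t k = Suc (length ?u)"
      using i_pos[OF k] len_runs[of "k - 1"] by (simp add: t_def)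
    ultimately show ?thesis
      using prob_pat_split[of W ?u True False ?v "t k" N] len
      by (simp only: prob_word_map_Not Omega'_eq_prob_word)
  qed
  have valley_term: "prob_pat (nth W) (s k) * prob_pat (\<lambda>q. W ! (q + Suc (s k))) (N - s k) =
      Omega' (if k = 0 then [] else runs i j 1 (k - 1) @ [i k, j k - 1]) *
      Omega' (if k = n then [] else (i (k + 1) - 1) # j (k + 1) # runs i j (k + 2) n)"
    if k: "k \<in> {0..n}" for k
  proof -
    let ?u = "word True (runs i j 1 (k - 1) @ [i k, j k - 1])"
    let ?v = "word True ((i (k + 1) - 1) # j (k + 1) # runs i j (k + 2) n)"
    have head: "W = word True (runs i j 1 k) @ True # ?v" if "k < n"
    proof -
      have k1: "k + 1 \<in> {1..n}" using that by auto
      show ?thesis unfolding W_split[OF k1] rep[OF i_pos[OF k1]] by simp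
    qed
    have tail: "word True (runs i j 1 k) = ?u @ [False]" "s k = Suc (length ?u)" if "0 < k"
    proof -
      have k1: "k \<in> {1..n}" using that k by auto
      have "runs i j 1 k = runs i j 1 (k - 1) @ [i k, j k]"
        using runs_split[of 1 k k i j] that by (simp add: runs_def)
      then show "word True (runs i j 1 k) = ?u @ [False]"
        by (simp add: word_append rep'[OF j_pos[OF k1]])
      then show "s k = Suc (length ?u)"
        using len_runs[of k] by simp
    qed
    \<comment> \<open>For \<open>k = 0\<close> the left piece has no entries, while the empty word
      behind \<open>Omega' []\<close> describes one entry; both have probability 1. The right piece
      for \<open>k = n\<close> is treated in the same way.\<close>
    have "prob_pat (nth W) (s k) = Omega' (if k = 0 then [] else runs i j 1 (k - 1) @ [i k, j k - 1])"
    proof (cases "k = 0")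
      case True
      then show ?thesis by (simp add: s_def)
    next
      case False
      obtain v where "W = word True (runs i j 1 k) @ v"
        using head k W_def by (cases "k = n") auto
      then have "W = ?u @ False # v" using tail(1) False by simp
      then show ?thesis
        using prob_pat_take[of ?u "False # v"] tail(2) False by (simp add: Omega'_eq_prob_word)
    qed
    moreover have "prob_pat (\<lambda>q. W ! (q + Suc (s k))) (N - s k) =
        Omega' (if k = n then [] else (i (k + 1) - 1) # j (k + 1) # runs i j (k + 2) n)"
    proof (cases "k = n")
      case True
      then show ?thesis by (simp add: sN)
    next
      case False
      then have W: "W = (word True (runs i j 1 k) @ [True]) @ ?v" using head k by simp
      then have "N - s k = Suc (length ?v)"
        using len len_runs[of k] by (metis add_diff_cancel_left' append.assoc append_Cons append_Nil length_Cons length_append)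
      then show ?thesis
        using prob_pat_drop[of "word True (runs i j 1 k) @ [True]" ?v] False len_runs[of k]
        unfolding W[symmetric] Omega'_eq_prob_word by simp
    qed
    ultimately show ?thesis by simp
  qed
  \<comment> \<open>Injectivity of \<open>t\<close> and \<open>s\<close> turns the sums over peak
    and valley positions into sums over \<open>k\<close>.\<close>
  show ?thesis
    unfolding Omega'_runs
    using prob_pat_Suc[of "nth W" N] prob_pat_Suc_valley[of "nth W" N]
    unfolding peaks valleys
    by (simp only: sum.reindex[OF inj_t] sum.reindex[OF inj_s] o_def peak_term valley_term
        cong: sum.cong)
qed

end
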